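(* Let $A\subseteq\mathbb{R}$, let $f:A\times A\to\mathbb{R}$ be a factorable double function, and let $L=(L_1,L_2)\in A\times A$. If $f$ is double sequentially continuous at $L$, then $f$ is continuous at $L$.
   Context: A function $f:A\times A\to\mathbb{R}$ is called factorable if there are functions $g,h:A\to\mathbb{R}$ with $f(x,y)=g(x)h(y)$ for all $x,y\in A$. A double sequence is a family indexed by $(k,l)\in\mathbb{N}\times\mathbb{N}$, where $\mathbb{N}=\{1,2,3,\dots\}$. A double sequence $\{x_{k,l}\}$ in $\mathbb{R}$ or in $\mathbb{R}^2$ is $P$-convergent with $P$-limit $L$ (Pringsheim limit) if for every $\epsilon>0$ there is $N\in\mathbb{N}$ such that $|x_{k,l}-L|<\epsilon$ whenever $k,l>N$; here $|\cdot|$ is the absolute value on $\mathbb{R}$ or the Euclidean norm on $\mathbb{R}^2$. The function $f$ is double sequentially continuous at $L\in A\times A$ if, for every double sequence $\{x_{k,l}\}$ of points of $A\times A$ that is $P$-convergent with $P$-limit $L$, the double sequence $\{f(x_{k,l})\}$ is $P$-convergent with $P$-limit $f(L)$. Continuity is with respect to the usual topology on $A\times A\subseteq\mathbb{R}^2$. *)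

theory Defs
  imports "HOL-Analysis.Analysis"
begin

text \<open>
  Functions on \<open>A \<times> A\<close> are total functions on \<^typ>\<open>real \<times> real\<close> of which only the values on
  \<open>A \<times> A\<close> are ever constrained.  The norm on \<^typ>\<open>real \<times> real\<close> is the Euclidean one.
\<close>

definition factorable_on :: "real set \<Rightarrow> (real \<times> real \<Rightarrow> real) \<Rightarrow> bool" where
  "factorable_on A f \<longleftrightarrow>
     (\<exists>g h :: real \<Rightarrow> real. \<forall>x\<in>A. \<forall>y\<in>A. f (x, y) = g x * h y)"

text \<open>
  Double sequences are indexed by the positive integers, so entries \<open>x k l\<close> with \<open>k = 0\<close> or
  \<open>l = 0\<close> are junk values.
\<close>

definition P_convergent_to ::
  "(nat \<Rightarrow> nat \<Rightarrow> 'a::real_normed_vector) \<Rightarrow> 'a \<Rightarrow> bool" where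
  "P_convergent_to x L \<longleftrightarrow>
     (\<forall>\<epsilon>>0. \<exists>N\<ge>1. \<forall>k l. k > N \<and> l > N \<longrightarrow> norm (x k l - L) < \<epsilon>)"

definition double_seq_continuous_at ::
  "real set \<Rightarrow> (real \<times> real \<Rightarrow> real) \<Rightarrow> real \<times> real \<Rightarrow> bool" where
  "double_seq_continuous_at A f L \<longleftrightarrow>
     (\<forall>x :: nat \<Rightarrow> nat \<Rightarrow> real \<times> real.
        (\<forall>k\<ge>1. \<forall>l\<ge>1. x k l \<in> A \<times> A) \<longrightarrow> P_convergent_to x L \<longrightarrow>
        P_convergent_to (\<lambda>k l. f (x k l)) (f L))"

end

theory Submission
  imports Defs
begin

text \<open>
  An ordinary sequence \<open>s\<close> becomes a double sequence by repeating it along the second index,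
  \<open>x k l = s k\<close>, and this \<open>x\<close> has the Pringsheim limit \<open>p\<close> exactly when \<open>s\<close> tends to \<open>p\<close>
  (\<open>P_convergent_to_const_in_second\<close>).  Applying a function to the entries of \<open>x\<close> again gives a
  double sequence of this form, so double sequential continuity contains ordinary sequential
  continuity as the special case of these double sequences.  In the metrizable space
  \<^typ>\<open>real \<times> real\<close>, sequential continuity at a point relative to a set is continuity there.
\<close>

text \<open>
  The Pringsheim condition constrains only entries with both indices large, but every large first
  index occurs in such an entry.
\<close>

lemma P_convergent_to_const_in_second:
  fixes s :: "nat \<Rightarrow> 'a::real_normed_vector"
  shows "P_convergent_to (\<lambda>k l. s k) p \<longleftrightarrow> s \<longlonglongrightarrow> p"
proof
  assume P: "P_convergent_to (\<lambda>k l. s k) p"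
  show "s \<longlonglongrightarrow> p"
  proof (rule LIMSEQ_I)
    fix e :: real
    assume "e > 0"
    then obtain N where N: "\<And>k l. k > N \<Longrightarrow> l > N \<Longrightarrow> norm (s k - p) < e"
      using P unfolding P_convergent_to_def by blast
    have "\<forall>n\<ge>Suc N. norm (s n - p) < e"
      using N by (meson Suc_le_lessD)
    then show "\<exists>N. \<forall>n\<ge>N. norm (s n - p) < e" ..
  qed
next
  assume lim: "s \<longlonglongrightarrow> p"
  show "P_convergent_to (\<lambda>k l. s k) p"
    unfolding P_convergent_to_def
  proof (intro allI impI)
    fix e :: real
    assume "e > 0"
    then obtain N where "\<forall>n\<ge>N. norm (s n - p) < e"
      using LIMSEQ_D[OF lim] by blast
    then have "\<forall>k l. k > Suc N \<and> l > Suc N \<longrightarrow> norm (s k - p) < e"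
      by simp
    then show "\<exists>N\<ge>1. \<forall>k l. k > N \<and> l > N \<longrightarrow> norm (s k - p) < e"
      by (intro exI[of _ "Suc N"]) simp
  qed
qed

theorem theorem3p1:
  fixes A :: "real set" and f :: "real \<times> real \<Rightarrow> real" and L1 L2 :: real
  assumes "factorable_on A f"
    and "(L1, L2) \<in> A \<times> A"
    and "double_seq_continuous_at A f (L1, L2)"
  shows "continuous (at (L1, L2) within A \<times> A) f"
  unfolding continuous_within_sequentially
proof (intro allI impI, elim conjE)
  fix s :: "nat \<Rightarrow> real \<times> real"
  assume s_in: "\<forall>n. s n \<in> A \<times> A" and "s \<longlonglongrightarrow> (L1, L2)"
  then have "P_convergent_to (\<lambda>k l. s k) (L1, L2)"
    by (simp only: P_convergent_to_const_in_second)
  then have "P_convergent_to (\<lambda>k l. f (s k)) (f (L1, L2))"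
    using assms(3)[unfolded double_seq_continuous_at_def, rule_format, of "\<lambda>k l. s k"] s_in
    by simp
  then show "(f \<circ> s) \<longlonglongrightarrow> f (L1, L2)"
    by (simp only: P_convergent_to_const_in_second comp_def)
qed

end
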